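(* Let $q$ be a prime power and $m\ge 1$ an integer. Let $f_1,f_2\in\mathbb{F}_q[x]$ satisfy $x^m-1=f_1(x)f_2(x)$, let $g\in\mathbb{F}_q[x]$ be a monic divisor of $x^m-1$, and let $\alpha\in\mathbb{F}_{q^m}$ have $\mathbb{F}_q$-Order $f_1$. Then $$\sum_{\chi}\chi(\alpha)=\mu(d)\,\frac{\phi(g)}{\phi(d)},\qquad d(x)=\frac{g(x)}{\gcd(g(x),f_2(x))},$$ where the sum runs over all additive characters $\chi$ of $\mathbb{F}_{q^m}$ of $\mathbb{F}_q$-Order $g$.
   Context: For $l(x)=\sum_{i=0}^n a_i x^i\in\mathbb{F}_q[x]$ and $\gamma\in\mathbb{F}_{q^m}$, write $l\circ\gamma=\sum_{i=0}^n a_i\gamma^{q^i}$. The $\mathbb{F}_q$-Order of an element $\gamma\in\mathbb{F}_{q^m}$ is the unique monic polynomial $f\in\mathbb{F}_q[x]$ of least degree with $f\circ\gamma=0$. An additive character of $\mathbb{F}_{q^m}$ is a group homomorphism $\chi:(\mathbb{F}_{q^m},+)\to\mathbb{C}^*$; its $\mathbb{F}_q$-Order is the unique monic polynomial $f\in\mathbb{F}_q[x]$ of least degree such that $\chi(f\circ\gamma)=1$ for all $\gamma\in\mathbb{F}_{q^m}$. For a nonzero $f\in\mathbb{F}_q[x]$: $\phi(f)$ is the number of polynomials in $\mathbb{F}_q[x]$ of degree less than $\deg f$ that are coprime to $f$ (with $\phi(1)=1$); $\mu(f)=(-1)^r$ if $f$ is the product of $r$ distinct irreducible polynomials (with $\mu(1)=1$),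 and $\mu(f)=0$ otherwise. Gcds of polynomials are taken to be monic. *)

theory Defs
  imports Complex_Main "HOL-Library.Cardinality" "HOL-Library.FuncSet"
    "HOL-Computational_Algebra.Computational_Algebra"
begin

text \<open>
  The fields \<open>F\<^sub>q\<close> and \<open>F\<close> (of order \<open>q^m\<close>) are types \<open>'k\<close> and \<open>'a\<close> of
  class \<open>finite\<close>, with \<open>q = CARD('k)\<close>; the inclusion of \<open>F\<^sub>q\<close> in \<open>F\<close> is an
  explicit field homomorphism \<open>\<iota>\<close>.
\<close>

definition field_embedding :: "('k::field \<Rightarrow> 'a::field) \<Rightarrow> bool" where
  "field_embedding \<iota> \<longleftrightarrow>
     \<iota> 1 = 1 \<and> (\<forall>x y. \<iota> (x + y) = \<iota> x + \<iota> y) \<and> (\<forall>x y. \<iota> (x * y) = \<iota> x * \<iota> y)"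

definition fq_action :: "('k::{finite,field} \<Rightarrow> 'a::field) \<Rightarrow> 'k poly \<Rightarrow> 'a \<Rightarrow> 'a" where
  "fq_action \<iota> l \<gamma> = (\<Sum>i\<le>degree l. \<iota> (coeff l i) * \<gamma> ^ (CARD('k) ^ i))"

definition least_monic :: "('k::field poly \<Rightarrow> bool) \<Rightarrow> 'k poly" where
  "least_monic P = (THE f. lead_coeff f = 1 \<and> P f \<and>
     (\<forall>h. lead_coeff h = 1 \<and> P h \<longrightarrow> degree f \<le> degree h))"

definition fq_Order :: "('k::{finite,field} \<Rightarrow> 'a::field) \<Rightarrow> 'a \<Rightarrow> 'k poly" where
  "fq_Order \<iota> \<gamma> = least_monic (\<lambda>f. fq_action \<iota> f \<gamma> = 0)"

definition additive_character :: "('a::field \<Rightarrow> complex) \<Rightarrow> bool" where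
  "additive_character \<chi> \<longleftrightarrow> (\<forall>x. \<chi> x \<noteq> 0) \<and> (\<forall>x y. \<chi> (x + y) = \<chi> x * \<chi> y)"

definition char_Order ::
    "('k::{finite,field} \<Rightarrow> 'a::field) \<Rightarrow> ('a \<Rightarrow> complex) \<Rightarrow> 'k poly" where
  "char_Order \<iota> \<chi> = least_monic (\<lambda>f. \<forall>\<gamma>. \<chi> (fq_action \<iota> f \<gamma>) = 1)"

text \<open>
  Here \<open>degree 0 = 0\<close>, whereas the zero polynomial has to count as having degree less than
  \<open>degree f\<close> even for constant \<open>f\<close>; this gives \<open>poly_phi 1 = 1\<close>.
\<close>

definition poly_phi :: "'k::field poly \<Rightarrow> nat" where
  "poly_phi f = card {h. (h = 0 \<or> degree h < degree f) \<and> coprime h f}"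

text \<open>
  The irreducible factors are taken monic, so that distinct factors are non-associated, and
  the leading coefficient is split off; the latter is vacuous for monic \<open>f\<close>.
\<close>

definition distinct_irreducible_product :: "'k::field poly \<Rightarrow> nat \<Rightarrow> bool" where
  "distinct_irreducible_product f r \<longleftrightarrow> f \<noteq> 0 \<and>
     (\<exists>A. finite A \<and> card A = r \<and> (\<forall>p\<in>A. irreducible p \<and> lead_coeff p = 1) \<and>
          f = smult (lead_coeff f) (\<Prod>A))"

definition poly_mu :: "'k::field poly \<Rightarrow> int" where
  "poly_mu f = (if \<exists>r. distinct_irreducible_product f r
                then (-1) ^ (THE r. distinct_irreducible_product f r) else 0)"


lemma poly_phi_1: "poly_phi 1 = 1"
proof -
  have "{h::'a poly. (h = 0 \<or> degree h < degree (1::'a poly)) \<and> coprime h 1} = {0}"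
    by auto
  then show ?thesis by (simp add: poly_phi_def)
qed

lemma least_monic_ex1:
  fixes P :: "'k::field poly \<Rightarrow> bool"
  assumes diff: "\<And>f h. P f \<Longrightarrow> P h \<Longrightarrow> P (f - h)"
    and smult: "\<And>c f. P f \<Longrightarrow> P (smult c f)"
    and ex: "\<exists>f. f \<noteq> 0 \<and> P f"
  shows "\<exists>!f. lead_coeff f = 1 \<and> P f \<and>
           (\<forall>h. lead_coeff h = 1 \<and> P h \<longrightarrow> degree f \<le> degree h)"
proof -
  from ex obtain f0 where f0: "f0 \<noteq> 0" "P f0" by blast
  then have "lead_coeff (smult (inverse (lead_coeff f0)) f0) = 1" by simp
  with f0 smult have "\<exists>f. lead_coeff f = 1 \<and> P f" by blast
  then obtain f where f: "lead_coeff f = 1 \<and> P f"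
      "\<forall>h. lead_coeff h = 1 \<and> P h \<longrightarrow> degree f \<le> degree h"
    using ex_has_least_nat[of "\<lambda>f. lead_coeff f = 1 \<and> P f" _ degree] by blast
  have "h = f" if h: "lead_coeff h = 1" "P h"
      "\<forall>l. lead_coeff l = 1 \<and> P l \<longrightarrow> degree h \<le> degree l" for h
  proof (rule ccontr)
    assume "h \<noteq> f"
    define e where "e = h - f"
    have deg: "degree h = degree f" using f h by (intro le_antisym) auto
    have e: "e \<noteq> 0" "P e" using \<open>h \<noteq> f\<close> diff[of h f] f(1) h(2) by (auto simp: e_def)
    then have "lead_coeff (smult (inverse (lead_coeff e)) e) = 1"
        and "P (smult (inverse (lead_coeff e)) e)"
      using smult by simp_all
    then have "degree f \<le> degree (smult (inverse (lead_coeff e)) e)" using f by blast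
    then have "degree f \<le> degree e" using e by simp
    moreover have "degree e \<le> degree f"
      using degree_diff_le_max[of h f] deg by (simp add: e_def)
    ultimately have "degree e = degree f" by simp
    then have "lead_coeff e = 0" using f h deg by (simp add: e_def)
    then show False using e by simp
  qed
  then show ?thesis using f by (intro ex1I[of _ f]) auto
qed

text \<open>In particular, a sum over additive characters is not the default \<open>0\<close> of an infinite sum.\<close>

lemma finite_additive_characters:
  "finite {\<chi> :: 'a::{finite,field} \<Rightarrow> complex. additive_character \<chi>}"
proof (rule finite_subset)
  let ?S = "{z::complex. z ^ CARD('a) = 1}"
  have "finite ?S"
    using finite_roots_unity[of "CARD('a)"] by (simp add: Suc_leI)
  then show "finite (PiE (UNIV :: 'a set) (\<lambda>_. ?S))"
    by (intro finite_PiE) auto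
  show "{\<chi> :: 'a \<Rightarrow> complex. additive_character \<chi>} \<subseteq> PiE UNIV (\<lambda>_. ?S)"
  proof
    fix \<chi> :: "'a \<Rightarrow> complex"
    assume "\<chi> \<in> {\<chi>. additive_character \<chi>}"
    then have nz: "\<chi> y \<noteq> 0" and add: "\<chi> (x + y) = \<chi> x * \<chi> y" for x y
      by (auto simp: additive_character_def)
    have "\<chi> x ^ CARD('a) = 1" for x
    proof -
      have "(\<Prod>y\<in>UNIV. \<chi> y) = (\<Prod>y\<in>UNIV. \<chi> (x + y))"
        by (rule prod.reindex_bij_witness[of _ "\<lambda>y. x + y" "\<lambda>y. y - x"]) auto
      also have "\<dots> = \<chi> x ^ CARD('a) * (\<Prod>y\<in>UNIV. \<chi> y)"
        by (simp add: add prod.distrib)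
      finally show ?thesis using nz by simp
    qed
    then show "\<chi> \<in> PiE UNIV (\<lambda>_. ?S)" by (simp add: PiE_def Pi_def)
  qed
qed

end

theory Submission
  imports Defs
begin

text \<open>
  Write \<open>q\<close> for the order of the small field and \<open>f \<bullet> \<gamma>\<close> for the action of a polynomial, under which
  the large field is a module over the polynomial ring. The Order of a character divides \<open>h\<close> iff the
  character is trivial on the image of \<open>h\<close>. By duality between characters and subgroups, the sum of
  \<open>\<chi> \<alpha>\<close> over these characters is the index of that image if \<open>\<alpha>\<close> lies in it, and \<open>0\<close> otherwise
  (\<open>sum_trivial_on_subgroup_characters\<close>). For a factorisation \<open>x^m - 1 = h k\<close>, counting roots of
  linearised polynomials shows that the kernel of \<open>h\<close> has exactly \<open>q^(degree h)\<close> elements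
  and that the image of \<open>h\<close> is the kernel of \<open>k\<close> (\<open>card_kernel_and_range_act\<close>). So the sum equals
  \<open>q^(degree h)\<close> if the Order \<open>f1\<close> of \<open>\<alpha>\<close> divides \<open>k\<close>, that is, if \<open>h\<close> divides \<open>f2\<close>, and \<open>0\<close>
  otherwise (\<open>sum_characters_Order_dvd\<close>).

  Passing from Order dividing \<open>g\<close> to Order equal to \<open>g\<close> is inclusion-exclusion over the sets \<open>B\<close> of
  prime factors of \<open>g\<close>: an Order \<open>f\<close> that divides \<open>g\<close> differs from \<open>g\<close> iff \<open>f p\<close> still divides \<open>g\<close>
  for some prime \<open>p\<close>, and \<open>f p\<close> divides \<open>g\<close> for all \<open>p\<close> in \<open>B\<close> iff \<open>f\<close> divides \<open>g / \<Prod>B\<close>. Since \<open>g / \<Prod>B\<close> divides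
  \<open>f2\<close> iff \<open>d\<close> divides \<open>\<Prod>B\<close>, the result is the sum of \<open>(-1)^|B| q^(degree g - degree \<Prod>B)\<close> over
  the sets \<open>B\<close> with \<open>d\<close> dividing \<open>\<Prod>B\<close>. This is the polynomial form of a Ramanujan sum, and it is
  evaluated in \<open>alternating_sum_eq_mu_phi\<close>: there is no such \<open>B\<close> unless \<open>d\<close> is squarefree, and otherwise
  the sum over the supersets of the primes of \<open>d\<close> splits into a product over primes, as \<open>\<phi>\<close> does.
\<close>

section \<open>Inclusion-exclusion over sets of primes\<close>

text \<open>
  Inclusion-exclusion in weighted form: expand \<open>\<Prod>p\<in>P. 1 - [R p x]\<close>, which is the indicator of
  avoiding every \<open>R p\<close>.
\<close>

lemma sum_avoiding_eq_alternating_sum: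
  fixes w :: "'x \<Rightarrow> 'c::comm_ring_1"
  assumes "finite X" "finite P"
  shows "(\<Sum>x | x \<in> X \<and> (\<forall>p\<in>P. \<not> R p x). w x)
       = (\<Sum>B\<in>Pow P. (-1) ^ card B * (\<Sum>x | x \<in> X \<and> (\<forall>p\<in>B. R p x). w x))"
proof -
  have bool_prod: "(\<Prod>p\<in>B. of_bool (Q p)) = (of_bool (\<forall>p\<in>B. Q p) :: 'c)" if "finite B" for B Q
    using that by (induction B) auto
  have ind: "of_bool (\<forall>p\<in>P. \<not> R p x)
          = (\<Sum>B\<in>Pow P. (-1) ^ card B * of_bool (\<forall>p\<in>B. R p x) :: 'c)" for x
  proof -
    have "of_bool (\<forall>p\<in>P. \<not> R p x) = (\<Prod>p\<in>P. of_bool (\<not> R p x) :: 'c)"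
      by (simp add: bool_prod assms)
    also have "\<dots> = (\<Prod>p\<in>P. 1 - of_bool (R p x))"
      by (rule prod.cong) auto
    also have "\<dots> = (\<Sum>B\<in>Pow P. (-1) ^ card B * (\<Prod>p\<in>B. of_bool (R p x)))"
      by (simp add: prod_diff_conv_sum assms)
    also have "\<dots> = (\<Sum>B\<in>Pow P. (-1) ^ card B * of_bool (\<forall>p\<in>B. R p x))"
      using assms by (intro sum.cong) (auto simp: bool_prod finite_subset)
    finally show ?thesis .
  qed
  have restrict: "(\<Sum>x | x \<in> X \<and> Q x. w x) = (\<Sum>x\<in>X. of_bool (Q x) * w x)" for Q
    using assms(1) by (simp add: of_bool_def if_distrib[of "\<lambda>c. c * _"] sum.inter_filter cong: if_cong)
  show ?thesis
    unfolding restrict ind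
    by (simp add: sum_distrib_left sum_distrib_right mult.assoc sum.swap[of _ X "Pow P"])
qed

text \<open>
  A superset of \<open>D\<close> is \<open>D\<close> together with an arbitrary subset of \<open>P - D\<close>, and the product over
  \<open>P - D\<close> expands into the sum over these subsets.
\<close>

lemma sum_supersets_prod:
  fixes w :: "'x \<Rightarrow> 'c::comm_ring_1"
  assumes "finite P" "D \<subseteq> P"
  shows "(\<Sum>B | D \<subseteq> B \<and> B \<subseteq> P. \<Prod>p\<in>B. w p) = (\<Prod>p\<in>D. w p) * (\<Prod>p\<in>P - D. 1 + w p)"
proof -
  have "(\<Prod>p\<in>P - D. 1 + w p) = (\<Prod>p\<in>P - D. w p + 1)"
    by (simp add: add.commute)
  also have "\<dots> = (\<Sum>C\<in>Pow (P - D). \<Prod>p\<in>C. w p)"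
    using assms by (simp add: prod_add)
  finally have "(\<Prod>p\<in>D. w p) * (\<Prod>p\<in>P - D. 1 + w p)
      = (\<Sum>C\<in>Pow (P - D). (\<Prod>p\<in>D. w p) * (\<Prod>p\<in>C. w p))"
    by (simp add: sum_distrib_left)
  also have "\<dots> = (\<Sum>B | D \<subseteq> B \<and> B \<subseteq> P. \<Prod>p\<in>B. w p)"
  proof (rule sum.reindex_bij_witness[of _ "\<lambda>B. B - D" "\<lambda>C. D \<union> C"])
    fix C assume "C \<in> Pow (P - D)"
    then show "(\<Prod>p\<in>D \<union> C. w p) = (\<Prod>p\<in>D. w p) * (\<Prod>p\<in>C. w p)"
      using assms by (intro prod.union_disjoint) (auto intro: finite_subset)
  qed (use assms in auto)
  finally show ?thesis ..
qed

lemma prod_primes_dvd_iff: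
  fixes h :: "'b::factorial_semiring_gcd"
  assumes "finite B" "\<And>p. p \<in> B \<Longrightarrow> prime p"
  shows "\<Prod>B dvd h \<longleftrightarrow> (\<forall>p\<in>B. p dvd h)"
  using assms
proof (induction B rule: finite_induct)
  case (insert p B)
  have "coprime p (\<Prod>B)"
    using insert by (intro prod_coprime_right) (metis insertCI primes_coprime)
  with insert show ?case
    by (auto intro: divides_mult dvd_mult_left dvd_mult_right)
qed simp

lemma prime_factors_prod_primes:
  fixes B :: "'b::factorial_semiring set"
  assumes "finite B" "\<And>p. p \<in> B \<Longrightarrow> prime p"
  shows "prime_factors (\<Prod>B) = B"
proof -
  have "0 \<notin> B" using assms(2) by (metis not_prime_0)
  then show ?thesis
    using assms by (subst prime_factors_prod) (auto simp: prime_prime_factors)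
qed

section \<open>Moebius and totient functions of polynomials over a finite field\<close>

lemma card_field_ge_2: "CARD('b::{finite,field}) \<ge> 2"
  using card_mono[of UNIV "{0, 1 :: 'b}"] by simp

text \<open>
  Over a field, normalised means monic, so the elements of \<open>prime_factors f\<close> are the monic irreducible
  factors of \<open>f\<close>, as in the definition of \<open>\<mu>\<close>.
\<close>

lemma prime_poly_iff_monic_irreducible:
  fixes p :: "'k::field_gcd poly"
  shows "prime p \<longleftrightarrow> irreducible p \<and> lead_coeff p = 1"
proof -
  have *: "unit_factor p = 1 \<longleftrightarrow> lead_coeff p = 1" if "p \<noteq> 0"
    using that by (simp add: unit_factor_poly_def one_pCons is_unit_unit_factor dvd_field_iff)
  have "normalize p = p \<longleftrightarrow> lead_coeff p = 1" if "p \<noteq> 0"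
    using that * by (metis mult_cancel_right1 normalize_1_iff unit_factor_mult_normalize unit_factor_normalize mult_1)
  then show ?thesis
    by (metis irreducible_imp_prime_elem prime_def prime_elem_imp_irreducible prime_elem_not_zeroI)
qed

lemma monic_dvd_antisym:
  fixes f h :: "'k::field poly"
  assumes "lead_coeff f = 1" "lead_coeff h = 1" "f dvd h" "h dvd f"
  shows "f = h"
proof -
  obtain c where c: "h = f * c" using assms(3) by blast
  then have "lead_coeff c = 1" "degree h = degree f + degree c"
    using assms by (auto simp: lead_coeff_mult intro!: degree_mult_eq)
  moreover have "degree h \<le> degree f" using assms by (intro dvd_imp_degree_le) auto
  ultimately have "c = 1" by (metis add_le_same_cancel1 degree_eq_zeroE le_zero_eq lead_coeff_pCons(2) one_pCons)
  with c show ?thesis by simp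
qed

lemma distinct_irreducible_product_monic_iff:
  fixes f :: "'k::field_gcd poly"
  assumes "lead_coeff f = 1"
  shows "distinct_irreducible_product f r \<longleftrightarrow> f = \<Prod>(prime_factors f) \<and> r = card (prime_factors f)"
proof -
  have "f \<noteq> 0" using assms by auto
  have "prime_factors f = A" if "finite A" "\<forall>p\<in>A. prime p" "f = \<Prod>A" for A
    using that by (simp add: prime_factors_prod_primes)
  with \<open>f \<noteq> 0\<close> assms show ?thesis
    unfolding distinct_irreducible_product_def prime_poly_iff_monic_irreducible[symmetric]
    by (auto intro!: exI[of _ "prime_factors f"])
qed

lemma poly_mu_monic:
  fixes f :: "'k::field_gcd poly"
  assumes "lead_coeff f = 1"
  shows "poly_mu f = (if f = \<Prod>(prime_factors f) then (-1) ^ card (prime_factors f) else 0)"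
  unfolding poly_mu_def distinct_irreducible_product_monic_iff[OF assms] by auto

lemma card_poly_degree_less:
  "card {h :: 'k::{finite,field} poly. h = 0 \<or> degree h < n} = CARD('k) ^ n"
proof (induction n)
  case (Suc n)
  let ?S = "\<lambda>n. {h :: 'k poly. h = 0 \<or> degree h < n}"
  have "h \<in> (\<lambda>(a, f). pCons a f) ` (UNIV \<times> ?S n)" if "h \<in> ?S (Suc n)" for h
    using that by (cases h) (auto split: if_splits)
  moreover have "pCons a f \<in> ?S (Suc n)" if "f \<in> ?S n" for a f
    using that by auto
  ultimately have "?S (Suc n) = (\<lambda>(a, f). pCons a f) ` (UNIV \<times> ?S n)"
    by force
  moreover have "inj_on (\<lambda>(a, f). pCons a f) (UNIV \<times> ?S n)"
    by (auto simp: inj_on_def)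
  ultimately show ?case
    using Suc by (simp add: card_image card_cartesian_product)
qed simp

lemma card_multiples_degree_less:
  fixes b :: "'k::{finite,field} poly"
  assumes "b \<noteq> 0" "degree b \<le> n"
  shows "card {h. (h = 0 \<or> degree h < n) \<and> b dvd h} = CARD('k) ^ (n - degree b)"
proof -
  have "{h. (h = 0 \<or> degree h < n) \<and> b dvd h} = (*) b ` {k. k = 0 \<or> degree k < n - degree b}"
  proof -
    have "degree (b * k) < n \<longleftrightarrow> degree k < n - degree b" if "k \<noteq> 0" for k
      using assms that by (auto simp: degree_mult_eq)
    with assms(1) show ?thesis by (auto elim!: dvdE) metis
  qed
  moreover have "inj_on ((*) b) {k. k = 0 \<or> degree k < n - degree b}"
    using assms by (auto simp: inj_on_def)
  ultimately show ?thesis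
    by (simp add: card_image card_poly_degree_less)
qed

lemma coprime_iff_no_common_prime_factor:
  fixes f h :: "'b::factorial_semiring_gcd"
  assumes "f \<noteq> 0"
  shows "coprime h f \<longleftrightarrow> (\<forall>p\<in>prime_factors f. \<not> p dvd h)"
proof
  assume "coprime h f"
  then show "\<forall>p\<in>prime_factors f. \<not> p dvd h"
    by (metis coprime_common_divisor in_prime_factors_iff not_prime_unit)
next
  assume *: "\<forall>p\<in>prime_factors f. \<not> p dvd h"
  show "coprime h f"
  proof (rule ccontr)
    assume "\<not> coprime h f"
    then have "gcd h f \<noteq> 0" "\<not> is_unit (gcd h f)"
      using assms by (auto simp: is_unit_gcd)
    then obtain p where "prime p" "p dvd gcd h f"
      using prime_divisor_exists by blast
    with * assms show False by (auto simp: in_prime_factors_iff)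
  qed
qed

lemma inverse_card_power_degree_prod:
  fixes B :: "'k::{finite,field} poly set"
  assumes "\<And>p. p \<in> B \<Longrightarrow> p \<noteq> 0" 
  shows "(-1) ^ card B / of_nat (CARD('k)) ^ degree (\<Prod>B)
       = (\<Prod>p\<in>B. - 1 / (of_nat (CARD('k)) :: complex) ^ degree p)"
proof -
  have "degree (\<Prod>B) = (\<Sum>p\<in>B. degree p)"
    using assms by (intro degree_prod_sum_eq) auto
  then show ?thesis
    by (simp only: prod_dividef power_sum prod_constant)
qed

text \<open>
  Inclusion-exclusion over the prime factors of \<open>f\<close>: being coprime to \<open>f\<close> means avoiding each of
  them, and the multiples of \<open>\<Prod>B\<close> below the degree of \<open>f\<close> are counted exactly because \<open>\<Prod>B\<close>
  divides \<open>f\<close>. The factor is written \<open>1 + - 1 / q^degree p\<close> so that \<open>- 1 / q^degree p\<close> can serve as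
  the weight of \<open>p\<close> in \<open>sum_supersets_prod\<close>.
\<close>

lemma poly_phi_eq_prod:
  fixes f :: "'k::{finite,field_gcd} poly"
  assumes "f \<noteq> 0"
  shows "(of_nat (poly_phi f) :: complex)
       = of_nat (CARD('k)) ^ degree f
         * (\<Prod>p\<in>prime_factors f. 1 + - 1 / of_nat (CARD('k)) ^ degree p)"
proof -
  let ?q = "of_nat (CARD('k)) :: complex" and ?P = "prime_factors f"
  let ?X = "{h :: 'k poly. h = 0 \<or> degree h < degree f}"
  have "card ?X \<noteq> 0" by (subst card_poly_degree_less) simp
  then have fin: "finite ?X" by (rule card_ge_0_finite[OF neq0_conv[THEN iffD1]])
  have "of_nat (poly_phi f) = (\<Sum>h | h \<in> ?X \<and> (\<forall>p\<in>?P. \<not> p dvd h). 1 :: complex)"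
    by (simp add: poly_phi_def coprime_iff_no_common_prime_factor[OF assms])
  also have "\<dots> = (\<Sum>B\<in>Pow ?P. (-1) ^ card B * (\<Sum>h | h \<in> ?X \<and> (\<forall>p\<in>B. p dvd h). 1))"
    by (rule sum_avoiding_eq_alternating_sum) (use fin in auto)
  also have "\<dots> = (\<Sum>B\<in>Pow ?P. ?q ^ degree f * (\<Prod>p\<in>B. - 1 / ?q ^ degree p))"
  proof (rule sum.cong)
    fix B assume "B \<in> Pow ?P"
    then have B: "finite B" "\<And>p. p \<in> B \<Longrightarrow> prime p" "\<And>p. p \<in> B \<Longrightarrow> p dvd f"
      by (auto intro: finite_subset)
    have "\<Prod>B dvd f" using B by (simp add: prod_primes_dvd_iff)
    then have le: "degree (\<Prod>B) \<le> degree f" using assms by (rule dvd_imp_degree_le)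
    have "\<Prod>B \<noteq> 0" using \<open>\<Prod>B dvd f\<close> assms by auto
    have "(\<Sum>h | h \<in> ?X \<and> (\<forall>p\<in>B. p dvd h). 1 :: complex)
        = of_nat (card {h. (h = 0 \<or> degree h < degree f) \<and> \<Prod>B dvd h})"
      using B by (simp add: prod_primes_dvd_iff)
    also have "\<dots> = ?q ^ degree f / ?q ^ degree (\<Prod>B)"
      using card_multiples_degree_less[OF \<open>\<Prod>B \<noteq> 0\<close> le] le
        power_diff[of ?q "degree (\<Prod>B)" "degree f"]
      by (simp del: power_diff)
    also have "(-1) ^ card B * \<dots> = ?q ^ degree f * ((-1) ^ card B / ?q ^ degree (\<Prod>B))"
      by simp
    also have "\<dots> = ?q ^ degree f * (\<Prod>p\<in>B. - 1 / ?q ^ degree p)"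
      using B(2) by (subst inverse_card_power_degree_prod) (metis not_prime_0, simp)
    finally show "(-1) ^ card B * (\<Sum>h | h \<in> ?X \<and> (\<forall>p\<in>B. p dvd h). 1)
        = ?q ^ degree f * (\<Prod>p\<in>B. - 1 / ?q ^ degree p)" .
  qed simp
  also have "\<dots> = ?q ^ degree f * (\<Prod>p\<in>?P. 1 + - 1 / ?q ^ degree p)"
    using sum_supersets_prod[of ?P "{}" "\<lambda>p. - 1 / ?q ^ degree p"]
    by (simp add: Pow_def flip: sum_distrib_left)
  finally show ?thesis .
qed

text \<open>
  The analogue of Hoelder's formula for Ramanujan sums. A divisor of a product of distinct primes is
  squarefree, so the index set is empty if \<open>\<mu>(d) = 0\<close>. Otherwise \<open>d\<close> is the product of a set \<open>D\<close>
  of primes and \<open>B\<close> runs through the supersets of \<open>D\<close>; the primes in \<open>D\<close> contribute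
  \<open>\<mu>(d) / q^degree d\<close> and the others the Euler factors of \<open>\<phi>(g)\<close> that are missing in \<open>\<phi>(d)\<close>.
\<close>

lemma alternating_sum_eq_mu_phi:
  fixes g d :: "'k::{finite,field_gcd} poly"
  assumes g: "g \<noteq> 0" and d: "lead_coeff d = 1" "d dvd g"
  shows "(\<Sum>B | B \<subseteq> prime_factors g \<and> d dvd \<Prod>B.
            (-1) ^ card B * (of_nat (CARD('k)) ^ degree g / of_nat (CARD('k)) ^ degree (\<Prod>B)))
       = (of_int (poly_mu d) * of_nat (poly_phi g) / of_nat (poly_phi d) :: complex)"
proof (cases "d = \<Prod>(prime_factors d)")
  case False
  have "\<not> d dvd \<Prod>B" if "B \<subseteq> prime_factors g" for B
  proof
    assume "d dvd \<Prod>B"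
    have B: "finite B" "\<And>p. p \<in> B \<Longrightarrow> prime p" using that by (auto intro: finite_subset)
    have "squarefree (\<Prod>B)"
      using B by (intro squarefree_prod_coprime) (auto intro: primes_coprime squarefree_prime)
    then have "squarefree d" using \<open>d dvd \<Prod>B\<close> squarefree_mono by blast
    then have "multiplicity p d = 1" if "p \<in> prime_factors d" for p
      using that d squarefree_factorial_semiring'[of d] by (cases "d = 0") auto
    then have "\<Prod>(prime_factors d) = normalize d"
      using d by (subst prod_prime_factors[symmetric]) (auto simp: )
    also have "normalize d = d"
      using d by (auto simp: normalize_poly_def one_pCons[symmetric])
    finally show False using False by simp
  qed
  then have "{B. B \<subseteq> prime_factors g \<and> d dvd \<Prod>B} = {}" by blast
  with False d show ?thesis by (simp only: poly_mu_monic) simp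
next
  case True
  let ?q = "of_nat (CARD('k)) :: complex"
  let ?P = "prime_factors g" and ?D = "prime_factors d" and ?w = "\<lambda>p :: 'k poly. - 1 / ?q ^ degree p"
  have nz: "1 + ?w p \<noteq> 0" if "prime p" for p
  proof -
    have "degree p > 0" using that
      by (metis gr0I is_unit_iff_degree not_prime_0 not_prime_unit)
    then have "CARD('k) ^ degree p \<noteq> 1" using card_field_ge_2[where ?'b = 'k] by simp
    then have "?q ^ degree p \<noteq> 1" by (metis of_nat_eq_1_iff of_nat_power)
    then show ?thesis by simp
  qed
  have "d \<noteq> 0" using d by auto
  have DP: "?D \<subseteq> ?P" using d g by (intro dvd_prime_factors)
  have dvd_iff: "d dvd \<Prod>B \<longleftrightarrow> ?D \<subseteq> B" if "B \<subseteq> ?P" for B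
  proof
    have B: "finite B" "\<And>p. p \<in> B \<Longrightarrow> prime p" using that by (auto intro: finite_subset)
    show "?D \<subseteq> B" if "d dvd \<Prod>B"
    proof -
      have "\<Prod>B \<noteq> 0" using B by (metis not_prime_0 prod_zero_iff)
      then show ?thesis
        using dvd_prime_factors[OF _ that] B by (simp add: prime_factors_prod_primes)
    qed
    show "d dvd \<Prod>B" if "?D \<subseteq> B"
      using prod_dvd_prod_subset[OF B(1) that, of "\<lambda>p. p"] True by simp
  qed
  have "(\<Sum>B | B \<subseteq> ?P \<and> d dvd \<Prod>B. (-1) ^ card B * (?q ^ degree g / ?q ^ degree (\<Prod>B)))
      = (\<Sum>B | ?D \<subseteq> B \<and> B \<subseteq> ?P. ?q ^ degree g * (\<Prod>p\<in>B. ?w p))"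
  proof (rule sum.cong)
    fix B assume "B \<in> {B. ?D \<subseteq> B \<and> B \<subseteq> ?P}"
    then have "(\<Prod>p\<in>B. ?w p) = (-1) ^ card B / ?q ^ degree (\<Prod>B)"
      by (subst inverse_card_power_degree_prod) auto
    then show "(-1) ^ card B * (?q ^ degree g / ?q ^ degree (\<Prod>B)) = ?q ^ degree g * (\<Prod>p\<in>B. ?w p)"
      by simp
  qed (use dvd_iff in auto)
  also have "\<dots> = ?q ^ degree g * ((\<Prod>p\<in>?D. ?w p) * (\<Prod>p\<in>?P - ?D. 1 + ?w p))"
    by (simp add: sum_distrib_left[symmetric] sum_supersets_prod[OF _ DP])
  also have "(\<Prod>p\<in>?D. ?w p) = of_int (poly_mu d) / ?q ^ degree d"
  proof -
    have "(\<Prod>p\<in>?D. ?w p) = (-1) ^ card ?D / ?q ^ degree (\<Prod>?D)"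
      by (rule inverse_card_power_degree_prod[symmetric]) auto
    then show ?thesis
      by (simp add: poly_mu_monic[OF d(1)] True[symmetric])
  qed
  also have "(\<Prod>p\<in>?P - ?D. 1 + ?w p) = (\<Prod>p\<in>?P. 1 + ?w p) / (\<Prod>p\<in>?D. 1 + ?w p)"
    using nz DP by (subst prod_diff) auto
  finally show ?thesis
    by (simp add: poly_phi_eq_prod g \<open>d \<noteq> 0\<close>)
qed

section \<open>Additive characters trivial on a subgroup\<close>

lemma character_zero: "additive_character \<chi> \<Longrightarrow> \<chi> 0 = 1"
  unfolding additive_character_def by (metis add.right_neutral mult_cancel_left1)

lemma character_diff: "additive_character \<chi> \<Longrightarrow> \<chi> (x - y) = \<chi> x / \<chi> y"
  unfolding additive_character_def by (metis diff_add_cancel nonzero_mult_div_cancel_right)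

definition additive_subgroup :: "'a::ab_group_add set \<Rightarrow> bool" where
  "additive_subgroup S \<longleftrightarrow> 0 \<in> S \<and> (\<forall>x\<in>S. \<forall>y\<in>S. x - y \<in> S)"

lemma additive_subgroup_add: "additive_subgroup S \<Longrightarrow> x \<in> S \<Longrightarrow> y \<in> S \<Longrightarrow> x + y \<in> S"
  unfolding additive_subgroup_def by (metis diff_0 diff_minus_eq_add)

lemma additive_subgroup_diff: "additive_subgroup S \<Longrightarrow> x \<in> S \<Longrightarrow> y \<in> S \<Longrightarrow> x - y \<in> S"
  unfolding additive_subgroup_def by blast

lemma additive_subgroup_of_nat_mult:
  fixes x :: "'a::comm_ring_1"
  shows "additive_subgroup S \<Longrightarrow> x \<in> S \<Longrightarrow> of_nat n * x \<in> S"
  by (induction n) (auto simp: algebra_simps additive_subgroup_add, simp add: additive_subgroup_def)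

text \<open>
  Take a subgroup \<open>M\<close> maximal among those that contain \<open>S\<close> but not \<open>x\<close>. As the additive group has
  prime exponent \<open>p\<close>, every element lies in some coset \<open>j x + M\<close>: if \<open>y\<close> is not in \<open>M\<close>, then \<open>x\<close> is
  in the subgroup generated by \<open>M\<close> and \<open>y\<close>, and the coefficient of \<open>y\<close> is invertible modulo \<open>p\<close>.
  The coset determines \<open>j\<close> modulo \<open>p\<close>, and \<open>\<omega>^j\<close> for a nontrivial \<open>p\<close>-th root of unity \<open>\<omega>\<close> is the
  required character.
\<close>

lemma exists_separating_character:
  fixes S :: "'a::{finite,field} set"
  assumes S: "additive_subgroup S" and x: "x \<notin> S"
  shows "\<exists>\<chi>. additive_character \<chi> \<and> (\<forall>s\<in>S. \<chi> s = 1) \<and> \<chi> x \<noteq> 1"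
proof -
  define p where "p = CHAR('a)"
  have "prime p" unfolding p_def by (rule prime_CHAR_semidom) (simp add: finite_imp_CHAR_pos)
  have of_nat_inverse: "\<exists>u. of_nat k * of_nat u = (1 :: 'a)" if "\<not> p dvd k" for k
  proof -
    have "coprime k p" using \<open>prime p\<close> that by (metis coprime_commute prime_imp_coprime)
    moreover have "k \<noteq> 0" using that by (metis dvd_0_right)
    ultimately obtain u v where "k * u = p * v + 1"
      using bezout_nat[of k p] by (auto simp: coprime_iff_gcd_eq_1)
    then have "(of_nat (k * u) :: 'a) = of_nat (p * v + 1)" by simp
    then show ?thesis by (auto simp: p_def)
  qed
  obtain M where M: "additive_subgroup M" "S \<subseteq> M" "x \<notin> M"
    and max: "\<And>N. additive_subgroup N \<Longrightarrow> M \<subseteq> N \<Longrightarrow> x \<notin> N \<Longrightarrow> N = M"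
    using finite_has_maximal2[of "{M. additive_subgroup M \<and> S \<subseteq> M \<and> x \<notin> M}" S] assms
    by (smt (verit) finite mem_Collect_eq order.refl order_trans)
  note diffM = additive_subgroup_diff[OF M(1)] and addM = additive_subgroup_add[OF M(1)]
    and multM = additive_subgroup_of_nat_mult[OF M(1)]
  have zeroM: "0 \<in> M" using M(1) by (simp add: additive_subgroup_def)
  have multiple_in_M: "p dvd k" if "of_nat k * x \<in> M" for k
  proof (rule ccontr)
    assume "\<not> p dvd k"
    then obtain u where u: "of_nat k * of_nat u = (1 :: 'a)" using of_nat_inverse by blast
    have "of_nat u * (of_nat k * x) \<in> M" using that by (rule multM)
    also have "of_nat u * (of_nat k * x) = x" using u by (simp add: algebra_simps flip: mult.assoc)
    finally show False using M(3) by simp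
  qed
  have ex: "\<exists>j. y - of_nat j * x \<in> M" for y
  proof (cases "y \<in> M")
    case True
    then show ?thesis by (intro exI[of _ 0]) simp
  next
    case False
    define N where "N = {m' + of_nat k * y | m' k. m' \<in> M}"
    \<comment> \<open>Closure under subtraction uses \<open>- k y = (p - 1) k y\<close>, as only natural multiples of \<open>y\<close> occur.\<close>
    have "additive_subgroup N"
      unfolding additive_subgroup_def
    proof (intro conjI ballI)
      show "0 \<in> N" unfolding N_def using zeroM by (force intro: exI[of _ 0])
      fix a b assume "a \<in> N" "b \<in> N"
      then obtain m1 k1 m2 k2 where ab: "a = m1 + of_nat k1 * y" "m1 \<in> M"
        "b = m2 + of_nat k2 * y" "m2 \<in> M"
        unfolding N_def by blast
      have "of_nat (p - 1) = (-1 :: 'a)"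
        using \<open>prime p\<close> prime_ge_1_nat[of p] by (simp add: p_def of_nat_diff)
      then have "of_nat (k1 + (p - 1) * k2) = (of_nat k1 - of_nat k2 :: 'a)"
        by (simp only: of_nat_add of_nat_mult) simp
      then have "a - b = (m1 - m2) + of_nat (k1 + (p - 1) * k2) * y"
        using ab by (simp only:) (simp add: algebra_simps)
      then show "a - b \<in> N" unfolding N_def using ab diffM by blast
    qed
    moreover have "M \<subseteq> N" unfolding N_def by (force intro: exI[of _ 0])
    moreover have "0 + of_nat 1 * y \<in> N" unfolding N_def using zeroM by blast
    then have "y \<in> N" by simp
    ultimately have "x \<in> N" using max False by blast
    then obtain m' k where k: "x = m' + of_nat k * y" "m' \<in> M" unfolding N_def by blast
    have "\<not> p dvd k"
    proof
      assume "p dvd k"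
      then have "of_nat k = (0 :: 'a)" by (simp add: p_def of_nat_eq_0_iff_char_dvd)
      with k M(3) show False by simp
    qed
    then obtain u where u: "of_nat k * of_nat u = (1 :: 'a)" using of_nat_inverse by blast
    have "of_nat u * x = of_nat u * m' + (of_nat k * of_nat u) * y"
      using k by (simp add: algebra_simps)
    then have "y - of_nat u * x = 0 - of_nat u * m'" using u by simp
    also have "\<dots> \<in> M" using k zeroM by (intro diffM multM)
    finally show ?thesis by blast
  qed
  \<comment> \<open>There are \<open>p > 1\<close> roots of unity of order dividing \<open>p\<close>, so one of them is not \<open>1\<close>.\<close>
  have "card {z :: complex. z ^ p = 1} = p"
    using \<open>prime p\<close> by (intro card_roots_unity_eq) (simp add: prime_gt_0_nat)
  then have "{z :: complex. z ^ p = 1} \<noteq> {1}"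
    using \<open>prime p\<close> by (metis card_1_singleton_iff not_prime_1 One_nat_def)
  then obtain \<omega> :: complex where \<omega>: "\<omega> ^ p = 1" "\<omega> \<noteq> 1" by auto
  define \<chi> where "\<chi> y = \<omega> ^ (SOME j. y - of_nat j * x \<in> M)" for y
  have *: "\<omega> ^ i = \<omega> ^ j" if "y - of_nat i * x \<in> M" "y - of_nat j * x \<in> M" "i \<le> j" for y i j
  proof -
    have "of_nat (j - i) * x = (y - of_nat i * x) - (y - of_nat j * x)"
      using that(3) by (simp add: of_nat_diff algebra_simps)
    also have "\<dots> \<in> M" using that(1,2) by (rule diffM)
    finally have "p dvd j - i" by (rule multiple_in_M)
    then obtain c where "j = i + p * c" using \<open>i \<le> j\<close> by (metis dvdE le_add_diff_inverse)
    then show ?thesis using \<omega> by (simp add: power_add power_mult)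
  qed
  have \<chi>: "\<chi> y = \<omega> ^ i" if "y - of_nat i * x \<in> M" for y i
    using someI[of "\<lambda>j. y - of_nat j * x \<in> M", OF that] that *[of y]
    unfolding \<chi>_def by (metis nle_le)
  have "\<omega> \<noteq> 0" using \<omega> \<open>prime p\<close> by (metis power_0_left prime_gt_0_nat less_numeral_extra(3) zero_neq_one)
  have "\<chi> (y + z) = \<chi> y * \<chi> z" for y z
  proof -
    obtain i j where ij: "y - of_nat i * x \<in> M" "z - of_nat j * x \<in> M" using ex by metis
    have "y + z - of_nat (i + j) * x = (y - of_nat i * x) + (z - of_nat j * x)"
      by (simp add: algebra_simps)
    also have "\<dots> \<in> M" using ij by (rule addM)
    finally have "\<chi> (y + z) = \<omega> ^ (i + j)" by (rule \<chi>)
    with \<chi> ij show ?thesis by (simp add: power_add)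
  qed
  moreover have "\<chi> y \<noteq> 0" for y unfolding \<chi>_def using \<open>\<omega> \<noteq> 0\<close> by simp
  ultimately have "additive_character \<chi>" by (simp add: additive_character_def)
  moreover have "\<chi> s = 1" if "s \<in> S" for s using \<chi>[of s 0] that M(2) by auto
  moreover have "\<chi> x \<noteq> 1" using \<chi>[of x 1] zeroM \<omega> by simp
  ultimately show ?thesis by blast
qed

text \<open>
  Outside \<open>S\<close>, the sum is invariant under multiplication by \<open>\<chi>0 y \<noteq> 1\<close> for a separating character
  \<open>\<chi>0\<close>, so it vanishes. On \<open>S\<close> it is the number of these characters, which is found by summing over
  all \<open>y\<close> in both orders: only the trivial character has a nonzero sum over the whole field.
\<close>

lemma sum_trivial_on_subgroup_characters:
  fixes S :: "'a::{finite,field} set"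
  assumes S: "additive_subgroup S"
  shows "(\<Sum>\<chi> | additive_character \<chi> \<and> (\<forall>s\<in>S. \<chi> s = 1). \<chi> y)
       = (if y \<in> S then of_nat (CARD('a)) / of_nat (card S) else 0)"
proof -
  define X where "X = {\<chi> :: 'a \<Rightarrow> complex. additive_character \<chi> \<and> (\<forall>s\<in>S. \<chi> s = 1)}"
  have fin: "finite X"
    unfolding X_def by (rule finite_subset[OF _ finite_additive_characters]) auto
  have outside: "(\<Sum>\<chi>\<in>X. \<chi> y) = 0" if y: "y \<notin> S" for y
  proof -
    obtain \<chi>0 where \<chi>0: "additive_character \<chi>0" "\<forall>s\<in>S. \<chi>0 s = 1" "\<chi>0 y \<noteq> 1"
      using exists_separating_character[OF S y] by blast
    have nz: "\<chi>0 z \<noteq> 0" for z using \<chi>0(1) by (simp add: additive_character_def)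
    have "(\<Sum>\<chi>\<in>X. \<chi> y) = (\<Sum>\<chi>\<in>X. \<chi>0 y * \<chi> y)"
      by (rule sum.reindex_bij_witness[of _ "\<lambda>\<chi> z. \<chi>0 z * \<chi> z" "\<lambda>\<chi> z. \<chi> z / \<chi>0 z"])
         (use \<chi>0 nz in \<open>auto simp: X_def additive_character_def\<close>)
    then have "(1 - \<chi>0 y) * (\<Sum>\<chi>\<in>X. \<chi> y) = 0"
      by (simp add: left_diff_distrib sum_distrib_left[symmetric])
    then show ?thesis using \<chi>0(3) by simp
  qed
  have inside: "(\<Sum>\<chi>\<in>X. \<chi> y) = of_nat (card X)" if "y \<in> S" for y
    using that by (simp add: X_def)
  have "0 \<in> S" using S by (simp add: additive_subgroup_def)
  have total: "(\<Sum>y\<in>UNIV. \<chi> y) = (if \<chi> = (\<lambda>_. 1) then of_nat (CARD('a)) else 0)"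
    if "\<chi> \<in> X" for \<chi>
  proof (cases "\<chi> = (\<lambda>_. 1)")
    case False
    then obtain z where z: "\<chi> z \<noteq> 1" by auto
    have "(\<Sum>y\<in>UNIV. \<chi> y) = (\<Sum>y\<in>UNIV. \<chi> (z + y))"
      by (rule sum.reindex_bij_witness[of _ "\<lambda>y. z + y" "\<lambda>y. y - z"]) auto
    also have "\<dots> = \<chi> z * (\<Sum>y\<in>UNIV. \<chi> y)"
      using that by (simp add: X_def additive_character_def sum_distrib_left)
    finally have "(1 - \<chi> z) * (\<Sum>y\<in>UNIV. \<chi> y) = 0" by (simp add: algebra_simps)
    with z False show ?thesis by simp
  qed simp
  have "(\<lambda>_. 1) \<in> X" by (simp add: X_def additive_character_def)
  have "of_nat (card S) * of_nat (card X) = (\<Sum>y\<in>UNIV. if y \<in> S then of_nat (card X) else 0 :: complex)"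
    by (simp add: sum.If_cases)
  also have "\<dots> = (\<Sum>y\<in>UNIV. \<Sum>\<chi>\<in>X. \<chi> y)"
    using inside outside by (intro sum.cong) auto
  also have "\<dots> = (\<Sum>\<chi>\<in>X. \<Sum>y\<in>UNIV. \<chi> y)" by (rule sum.swap)
  also have "\<dots> = of_nat (CARD('a))"
    using \<open>(\<lambda>_. 1) \<in> X\<close> fin by (simp add: total sum.delta' cong: sum.cong)
  finally have eq: "of_nat (card S) * of_nat (card X) = (of_nat (CARD('a)) :: complex)" .
  have "of_nat (card X) = (of_nat (CARD('a)) / of_nat (card S) :: complex)"
  proof -
    have "card S \<noteq> 0" using \<open>0 \<in> S\<close> by auto
    with eq show ?thesis by (simp add: field_simps)
  qed
  then show ?thesis
    using inside outside unfolding X_def by auto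
qed

section \<open>Polynomials acting on the extension field\<close>

lemma finite_field_power_card:
  fixes x :: "'b::{finite,field}"
  shows "x ^ CARD('b) = x"
proof (cases "x = 0")
  case False
  let ?U = "UNIV - {0 :: 'b}"
  have "(\<Prod>y\<in>?U. y) = (\<Prod>y\<in>?U. x * y)"
    by (rule prod.reindex_bij_witness[of _ "\<lambda>y. x * y" "\<lambda>y. y / x"]) (use False in auto)
  then have "x ^ card ?U = 1" by (simp add: prod.distrib)
  moreover have "CARD('b) = Suc (card ?U)" by (simp add: card_Suc_Diff1)
  ultimately show ?thesis by (metis mult_1_right power_Suc)
qed simp

text \<open>
  This makes the power map \<open>x \<mapsto> x^q\<close> additive. The \<open>j\<close>-th coefficient of \<open>(x + 1)^q - x^q - 1\<close> is
  the binomial coefficient; this polynomial has degree less than \<open>q\<close> and vanishes at all \<open>q\<close> elements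
  of the field, because \<open>a^q = a\<close>, so it is zero.
\<close>

lemma choose_card_eq_0:
  assumes "0 < j" "j < CARD('k::{finite,field})"
  shows "of_nat (CARD('k) choose j) = (0 :: 'k)"
proof -
  let ?q = "CARD('k)"
  define f :: "'k poly" where "f = [:1, 1:] ^ ?q - monom 1 ?q - 1"
  have "coeff f i = 0" if "i \<ge> ?q" for i
  proof (cases "i = ?q")
    case False
    then show ?thesis using that by (simp add: f_def coeff_eq_0 degree_linear_power)
  qed (use assms in \<open>simp add: f_def coeff_linear_power\<close>)
  then have "degree f < ?q" using assms by (metis leading_coeff_0_iff not_less order.strict_trans degree_0)
  moreover have "poly f x = 0" for x
    by (simp add: f_def poly_monom poly_power finite_field_power_card)
  ultimately have "f = 0" using card_poly_roots_bound[of f] by fastforce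
  moreover have "coeff f j = of_nat (?q choose j)"
    using assms by (simp add: f_def coeff_linear_poly_power)
  ultimately show ?thesis by simp
qed

locale finite_field_embedding =
  fixes \<iota> :: "'k::{finite,field_gcd} \<Rightarrow> 'a::{finite,field}"
  assumes embedding: "field_embedding \<iota>"
begin

abbreviation act (infixr "\<bullet>" 75) where "act \<equiv> fq_action \<iota>"

lemma \<iota>_1: "\<iota> 1 = 1" and \<iota>_add: "\<iota> (x + y) = \<iota> x + \<iota> y" and \<iota>_mult: "\<iota> (x * y) = \<iota> x * \<iota> y"
  using embedding by (auto simp: field_embedding_def)

lemma \<iota>_0: "\<iota> 0 = 0"
  using \<iota>_add[of 0 0] by (metis add.right_neutral add_left_cancel)

lemma \<iota>_of_nat: "\<iota> (of_nat n) = of_nat n"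
  by (induction n) (simp_all add: \<iota>_0 \<iota>_1 \<iota>_add)

lemma \<iota>_power: "\<iota> (x ^ n) = \<iota> x ^ n"
  by (induction n) (simp_all add: \<iota>_1 \<iota>_mult)

lemma \<iota>_eq_0_iff: "\<iota> x = 0 \<longleftrightarrow> x = 0"
  using \<iota>_mult[of x "inverse x"] by (cases "x = 0") (auto simp: \<iota>_0 \<iota>_1)

lemma \<iota>_diff: "\<iota> (x - y) = \<iota> x - \<iota> y"
  using \<iota>_add[of "x - y" y] by (simp add: algebra_simps)

lemma frobenius_add: "(x + y :: 'a) ^ CARD('k) = x ^ CARD('k) + y ^ CARD('k)"
proof -
  let ?q = "CARD('k)"
  have "?q > 0" by simp
  have "of_nat (?q choose j) = (0 :: 'a)" if "j \<in> {..?q} - {0, ?q}" for j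
    using that \<iota>_of_nat[of "?q choose j"] choose_card_eq_0[where ?'k = 'k, of j] by (auto simp: \<iota>_0)
  then have "(x + y) ^ ?q = (\<Sum>j\<in>{0, ?q}. of_nat (?q choose j) * x ^ j * y ^ (?q - j))"
    unfolding binomial_ring by (intro sum.mono_neutral_right) auto
  then show ?thesis using \<open>?q > 0\<close> by (simp add: add.commute)
qed

lemma frobenius_sum: "finite I \<Longrightarrow> (\<Sum>i\<in>I. f i :: 'a) ^ CARD('k) = (\<Sum>i\<in>I. f i ^ CARD('k))"
  by (induction I rule: finite_induct) (simp_all add: frobenius_add)

lemma frobenius_\<iota>: "\<iota> c ^ CARD('k) = \<iota> c"
  by (simp add: \<iota>_power[symmetric] finite_field_power_card)

lemma act_eq_sum:
  assumes "degree f \<le> n"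
  shows "f \<bullet> \<gamma> = (\<Sum>i\<le>n. \<iota> (coeff f i) * \<gamma> ^ (CARD('k) ^ i))"
  unfolding fq_action_def using assms
  by (intro sum.mono_neutral_left) (auto simp: coeff_eq_0 \<iota>_0)

text \<open>
  Horner's scheme for the action, from which its other properties follow by induction on the
  polynomial. It holds because the power map \<open>\<gamma> \<mapsto> \<gamma>^q\<close> is additive and fixes the image of \<open>\<iota>\<close>.
\<close>

lemma act_pCons: "pCons c f \<bullet> \<gamma> = \<iota> c * \<gamma> + (f \<bullet> \<gamma>) ^ CARD('k)"
proof -
  have "pCons c f \<bullet> \<gamma> = (\<Sum>i\<le>Suc (degree f). \<iota> (coeff (pCons c f) i) * \<gamma> ^ (CARD('k) ^ i))"
    by (rule act_eq_sum) (simp add: degree_pCons_le)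
  also have "\<dots> = \<iota> c * \<gamma> + (\<Sum>i\<le>degree f. \<iota> (coeff f i) * \<gamma> ^ (CARD('k) ^ Suc i))"
    by (simp add: sum.atMost_Suc_shift del: sum.atMost_Suc)
  also have "(\<Sum>i\<le>degree f. \<iota> (coeff f i) * \<gamma> ^ (CARD('k) ^ Suc i)) = (f \<bullet> \<gamma>) ^ CARD('k)"
    by (simp add: fq_action_def frobenius_sum power_mult_distrib frobenius_\<iota> mult.commute
        flip: power_mult)
  finally show ?thesis .
qed

lemma act_0: "0 \<bullet> \<gamma> = 0"
  by (simp add: fq_action_def \<iota>_0)

lemma act_diff_left: "(f - h) \<bullet> \<gamma> = f \<bullet> \<gamma> - h \<bullet> \<gamma>"
proof -
  define n where "n = max (degree f) (degree h)"
  have "degree f \<le> n" "degree h \<le> n" "degree (f - h) \<le> n"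
    by (auto simp: n_def degree_diff_le_max)
  then show ?thesis
    by (simp add: act_eq_sum \<iota>_diff left_diff_distrib sum_subtractf)
qed

lemma act_add_left: "(f + h) \<bullet> \<gamma> = f \<bullet> \<gamma> + h \<bullet> \<gamma>"
  using act_diff_left[of "f + h" h] by simp

lemma act_smult: "smult c f \<bullet> \<gamma> = \<iota> c * (f \<bullet> \<gamma>)"
  by (simp add: act_eq_sum[of _ "degree f"] degree_smult_le \<iota>_mult sum_distrib_left mult.assoc)

lemma act_mult: "(f * h) \<bullet> \<gamma> = f \<bullet> h \<bullet> \<gamma>"
  by (induction f) (simp_all add: act_0 act_add_left act_smult act_pCons \<iota>_0)

lemma act_add_right: "f \<bullet> (\<gamma> + \<delta>) = f \<bullet> \<gamma> + f \<bullet> \<delta>"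
  by (induction f) (simp_all add: act_0 act_pCons frobenius_add algebra_simps)

lemma act_diff_right: "f \<bullet> (\<gamma> - \<delta>) = f \<bullet> \<gamma> - f \<bullet> \<delta>"
  using act_add_right[of f "\<gamma> - \<delta>" \<delta>] by (simp add: algebra_simps)

lemma act_monom: "monom 1 n \<bullet> \<gamma> = \<gamma> ^ (CARD('k) ^ n)"
  by (induction n) (simp_all add: monom_0 monom_Suc act_pCons act_0 \<iota>_0 \<iota>_1 mult.commute flip: power_mult)

lemma additive_subgroup_range_act: "additive_subgroup (range (act h))"
  unfolding additive_subgroup_def
  by (auto simp: act_diff_right[symmetric]) (metis act_diff_right diff_self rangeI)

text \<open>
  The kernel consists of the roots of the linearised polynomial \<open>\<Sum>i. h\<^sub>i X^(q^i)\<close>.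
\<close>

lemma card_kernel_act_le:
  assumes "h \<noteq> 0"
  shows "card {\<gamma>. h \<bullet> \<gamma> = 0} \<le> CARD('k) ^ degree h"
proof -
  let ?q = "CARD('k)"
  define L where "L = (\<Sum>i\<le>degree h. monom (\<iota> (coeff h i)) (?q ^ i))"
  have "coeff L (?q ^ degree h) = (\<Sum>i\<le>degree h. if i = degree h then \<iota> (coeff h i) else 0)"
    unfolding L_def coeff_sum coeff_monom
    using card_field_ge_2[where ?'b = 'k] by (intro sum.cong) auto
  then have "coeff L (?q ^ degree h) \<noteq> 0" using assms by (simp add: \<iota>_eq_0_iff)
  then have "L \<noteq> 0" by auto
  have "degree (monom (\<iota> (coeff h i)) (?q ^ i)) \<le> ?q ^ degree h" if "i \<le> degree h" for i
  proof -
    have "degree (monom (\<iota> (coeff h i)) (?q ^ i)) \<le> ?q ^ i" by (rule degree_monom_le)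
    also have "\<dots> \<le> ?q ^ degree h" using that by (intro power_increasing) (simp_all add: Suc_leI)
    finally show ?thesis .
  qed
  then have "degree L \<le> ?q ^ degree h"
    unfolding L_def by (intro degree_sum_le) auto
  moreover have "poly L \<gamma> = h \<bullet> \<gamma>" for \<gamma>
    by (simp add: L_def fq_action_def poly_sum poly_monom)
  ultimately show ?thesis using card_poly_roots_bound[OF \<open>L \<noteq> 0\<close>] by simp
qed

lemma card_kernel_times_card_range:
  "card {\<gamma>. h \<bullet> \<gamma> = 0} * card (range (act h)) = CARD('a)"
proof -
  have fiber: "card {\<gamma>. h \<bullet> \<gamma> = y} = card {\<gamma>. h \<bullet> \<gamma> = 0}" if y: "y \<in> range (act h)" for y
  proof -
    obtain \<delta> where "y = h \<bullet> \<delta>" using y by auto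
    then have "bij_betw (\<lambda>\<gamma>. \<gamma> - \<delta>) {\<gamma>. h \<bullet> \<gamma> = y} {\<gamma>. h \<bullet> \<gamma> = 0}"
      by (intro bij_betwI[where g = "\<lambda>\<gamma>. \<gamma> + \<delta>"]) (auto simp: act_add_right act_diff_right)
    then show ?thesis by (rule bij_betw_same_card)
  qed
  have "CARD('a) = (\<Sum>y\<in>range (act h). card {\<gamma>. h \<bullet> \<gamma> = y})"
    using sum.image_gen[of UNIV "\<lambda>_. 1 :: nat" "act h"] by simp
  then show ?thesis by (simp add: fiber)
qed

end

section \<open>Orders in an extension of degree m\<close>

text \<open>
  The polynomials with property \<open>P\<close> form a nonzero ideal, and division with remainder by its monic
  element of least degree shows that this element generates it.
\<close>

lemma least_monic_generates:
  fixes P :: "'k::field_gcd poly \<Rightarrow> bool"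
  assumes diff: "\<And>f h. P f \<Longrightarrow> P h \<Longrightarrow> P (f - h)"
    and mult: "\<And>c f. P f \<Longrightarrow> P (c * f)"
    and ex: "\<exists>f. f \<noteq> 0 \<and> P f"
  shows "lead_coeff (least_monic P) = 1" and "P h \<longleftrightarrow> least_monic P dvd h"
proof -
  have smult: "P (smult c f)" if "P f" for c f
    using mult[OF that, of "[:c:]"] by simp
  let ?f = "least_monic P"
  have f: "lead_coeff ?f = 1" "P ?f" and
    min: "\<And>h. lead_coeff h = 1 \<Longrightarrow> P h \<Longrightarrow> degree ?f \<le> degree h"
    using theI'[OF least_monic_ex1[of P, OF diff smult ex]] unfolding least_monic_def by auto
  then show "lead_coeff ?f = 1" by blast
  show "P h \<longleftrightarrow> ?f dvd h"
  proof
    assume "?f dvd h"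
    then show "P h" using mult f by (metis dvd_def mult.commute)
  next
    assume "P h"
    define r where "r = h mod ?f"
    have "r = h - (h div ?f) * ?f" by (simp add: r_def minus_div_mult_eq_mod)
    then have "P r" using diff mult f \<open>P h\<close> by metis
    have "r = 0"
    proof (rule ccontr)
      assume "r \<noteq> 0"
      then have "degree ?f \<le> degree (smult (inverse (lead_coeff r)) r)"
        using smult[OF \<open>P r\<close>] by (intro min) auto
      then have "degree ?f \<le> degree r" using \<open>r \<noteq> 0\<close> by simp
      moreover have "degree r < degree ?f"
        using \<open>r \<noteq> 0\<close> f degree_mod_less[of ?f h] by (force simp: r_def)
      ultimately show False by simp
    qed
    then show "?f dvd h" by (simp add: r_def mod_eq_0_iff_dvd)
  qed
qed

locale finite_field_extension = finite_field_embedding \<iota>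
  for \<iota> :: "'k::{finite,field_gcd} \<Rightarrow> 'a::{finite,field}" +
  fixes m :: nat
  assumes m: "m \<ge> 1" and card: "CARD('a) = CARD('k) ^ m"
begin

abbreviation (input) modulus :: "'k poly" where "modulus \<equiv> monom 1 m - 1"

lemma act_modulus: "modulus \<bullet> \<gamma> = 0"
  using finite_field_power_card[of \<gamma>] act_monom[of 0 \<gamma>]
  by (simp add: act_diff_left act_monom card[symmetric] monom_0 one_pCons)

lemma degree_modulus: "degree modulus = m"
  using m degree_add_eq_left[of "-1 :: 'k poly" "monom 1 m"] by (simp add: degree_monom_eq)

lemma modulus_nonzero: "modulus \<noteq> 0"
  using degree_modulus m by auto

text \<open>
  The two kernels have at most \<open>q^degree h\<close> and \<open>q^degree k\<close> elements, the product of these bounds is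
  the order of the field, and the image of \<open>h\<close>, whose size is the index of the kernel of \<open>h\<close>, is
  contained in the kernel of \<open>k\<close>. So all the inequalities are equalities.
\<close>

lemma card_kernel_and_range_act:
  assumes hk: "h * k = modulus"
  shows "card {\<gamma>. h \<bullet> \<gamma> = 0} = CARD('k) ^ degree h" and "range (act h) = {\<gamma>. k \<bullet> \<gamma> = 0}"
proof -
  let ?q = "CARD('k)"
  have nz: "h \<noteq> 0" "k \<noteq> 0" using hk modulus_nonzero by auto
  have "degree h + degree k = m" using hk nz degree_modulus by (metis degree_mult_eq)
  then have q: "?q ^ degree h * ?q ^ degree k = CARD('a)" by (simp add: card power_add[symmetric])
  have "k \<bullet> h \<bullet> \<gamma> = 0" for \<gamma> by (metis act_modulus act_mult hk mult.commute)
  then have sub: "range (act h) \<subseteq> {\<gamma>. k \<bullet> \<gamma> = 0}" by auto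
  then have le: "card (range (act h)) \<le> card {\<gamma>. k \<bullet> \<gamma> = 0}" by (intro card_mono) auto
  have kle: "card {\<gamma>. k \<bullet> \<gamma> = 0} \<le> ?q ^ degree k" and hle: "card {\<gamma>. h \<bullet> \<gamma> = 0} \<le> ?q ^ degree h"
    using nz card_kernel_act_le by auto
  have eq: "card {\<gamma>. h \<bullet> \<gamma> = 0} * card (range (act h)) = ?q ^ degree h * ?q ^ degree k"
    using card_kernel_times_card_range q by simp
  have pos: "?q ^ degree h > 0" "?q ^ degree k > 0" by simp_all
  have "card (range (act h)) = ?q ^ degree k"
  proof (rule ccontr)
    assume "card (range (act h)) \<noteq> ?q ^ degree k"
    then have "card (range (act h)) < ?q ^ degree k" using le kle by simp
    then have "?q ^ degree h * card (range (act h)) < ?q ^ degree h * ?q ^ degree k"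
      using pos by simp
    moreover have "card {\<gamma>. h \<bullet> \<gamma> = 0} * card (range (act h)) \<le> ?q ^ degree h * card (range (act h))"
      using hle by (rule mult_right_mono) simp
    ultimately have "card {\<gamma>. h \<bullet> \<gamma> = 0} * card (range (act h)) < ?q ^ degree h * ?q ^ degree k"
      by (rule le_less_trans[rotated])
    with eq show False by simp
  qed
  with eq pos show "card {\<gamma>. h \<bullet> \<gamma> = 0} = ?q ^ degree h" by simp
  show "range (act h) = {\<gamma>. k \<bullet> \<gamma> = 0}"
    using sub le kle \<open>card (range (act h)) = ?q ^ degree k\<close> by (intro card_subset_eq) auto
qed

lemma fq_Order_dvd_iff: "fq_Order \<iota> \<alpha> dvd h \<longleftrightarrow> h \<bullet> \<alpha> = 0"
  unfolding fq_Order_def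
proof (rule least_monic_generates(2)[symmetric])
  show "\<exists>f. f \<noteq> 0 \<and> f \<bullet> \<alpha> = 0" using modulus_nonzero act_modulus by blast
  show "(c * f) \<bullet> \<alpha> = 0" if "f \<bullet> \<alpha> = 0" for c f
    using that act_diff_right[of c 0 0] by (simp add: act_mult)
qed (simp add: act_diff_left)

lemma char_Order:
  assumes "additive_character \<chi>"
  shows "lead_coeff (char_Order \<iota> \<chi>) = 1"
    and "char_Order \<iota> \<chi> dvd h \<longleftrightarrow> (\<forall>\<gamma>. \<chi> (h \<bullet> \<gamma>) = 1)"
proof -
  let ?P = "\<lambda>f. \<forall>\<gamma>. \<chi> (f \<bullet> \<gamma>) = 1"
  have 1: "?P (f - h)" if "?P f" "?P h" for f h
    using that by (simp add: act_diff_left character_diff[OF assms])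
  have 2: "?P (c * f)" if "?P f" for c f
    using that by (metis act_mult mult.commute)
  have 3: "\<exists>f. f \<noteq> 0 \<and> ?P f"
    using modulus_nonzero act_modulus character_zero[OF assms] by metis
  show "lead_coeff (char_Order \<iota> \<chi>) = 1"
    unfolding char_Order_def using 1 2 3 by (rule least_monic_generates(1))
  show "char_Order \<iota> \<chi> dvd h \<longleftrightarrow> ?P h"
    unfolding char_Order_def using 1 2 3 by (rule least_monic_generates(2)[symmetric])
qed

text \<open>
  With \<open>x^m - 1 = h k\<close>, the characters in question are those that are trivial on the image of \<open>h\<close>.
  The element \<open>\<alpha>\<close> lies in this image, which is the kernel of \<open>k\<close>, iff \<open>f1\<close> divides \<open>k\<close>; as
  \<open>h k = f1 f2\<close>, this means that \<open>h\<close> divides \<open>f2\<close>.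
\<close>

lemma sum_characters_Order_dvd:
  assumes f: "modulus = f1 * f2" and \<alpha>: "fq_Order \<iota> \<alpha> = f1" and h: "h dvd modulus"
  shows "(\<Sum>\<chi> | additive_character \<chi> \<and> char_Order \<iota> \<chi> dvd h. \<chi> \<alpha>)
       = (if h dvd f2 then of_nat (CARD('k)) ^ degree h else 0)"
proof -
  let ?q = "CARD('k)"
  obtain k where hk: "h * k = modulus" using h by (metis dvdE)
  have nz: "h \<noteq> 0" "f1 \<noteq> 0" using hk f modulus_nonzero by auto
  have "\<alpha> \<in> range (act h) \<longleftrightarrow> f1 dvd k"
    using card_kernel_and_range_act(2)[OF hk] fq_Order_dvd_iff[of \<alpha>] \<alpha> by simp
  also have "\<dots> \<longleftrightarrow> h * f1 dvd h * k" using nz by simp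
  also have "\<dots> \<longleftrightarrow> f1 * h dvd f1 * f2" using hk f by (simp add: mult.commute)
  also have "\<dots> \<longleftrightarrow> h dvd f2" using nz by simp
  finally have \<alpha>_iff: "\<alpha> \<in> range (act h) \<longleftrightarrow> h dvd f2" .
  have "card (range (act h)) > 0" by (simp add: card_gt_0_iff)
  then have quot: "of_nat (CARD('a)) / of_nat (card (range (act h))) = (of_nat ?q ^ degree h :: complex)"
    using card_kernel_times_card_range[of h, symmetric] card_kernel_and_range_act(1)[OF hk] by simp
  have "(\<Sum>\<chi> | additive_character \<chi> \<and> char_Order \<iota> \<chi> dvd h. \<chi> \<alpha>)
      = (\<Sum>\<chi> | additive_character \<chi> \<and> (\<forall>s\<in>range (act h). \<chi> s = 1). \<chi> \<alpha>)"
    by (rule sum.cong) (auto simp: char_Order(2))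
  also have "\<dots> = (if h dvd f2 then of_nat ?q ^ degree h else 0)"
    by (simp only: sum_trivial_on_subgroup_characters[OF additive_subgroup_range_act] \<alpha>_iff quot)
  finally show ?thesis .
qed

end

section \<open>Characters of a given Order\<close>

lemma dvd_mult_iff_div_gcd_dvd:
  fixes a b c :: "'b::semiring_gcd"
  assumes "a \<noteq> 0"
  shows "a dvd c * b \<longleftrightarrow> a div gcd a c dvd b"
proof -
  define e where "e = gcd a c"
  have e: "e \<noteq> 0" "a = e * (a div e)" "c = e * (c div e)"
    using assms by (simp_all add: e_def)
  have "coprime (a div e) (c div e)" unfolding e_def using assms by (intro div_gcd_coprime) auto
  have "a dvd c * b \<longleftrightarrow> e * (a div e) dvd e * ((c div e) * b)"
    using e by (metis mult.assoc)
  also have "\<dots> \<longleftrightarrow> a div e dvd (c div e) * b"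
    by (rule dvd_times_left_cancel_iff[OF e(1)])
  also have "\<dots> \<longleftrightarrow> a div e dvd b"
    using \<open>coprime (a div e) (c div e)\<close> by (rule coprime_dvd_mult_right_iff)
  finally show ?thesis by (simp add: e_def)
qed

text \<open>
  If the monic \<open>f\<close> divides \<open>g\<close> properly, then some prime \<open>p\<close> divides the cofactor \<open>g / f\<close>, so \<open>f p\<close> still
  divides \<open>g\<close>. This turns equality into the avoidance of finitely many conditions.
\<close>

lemma eq_iff_no_prime_gap:
  fixes f g :: "'k::field_gcd poly"
  assumes "lead_coeff f = 1" "lead_coeff g = 1"
  shows "f = g \<longleftrightarrow> f dvd g \<and> (\<forall>p\<in>prime_factors g. \<not> f * p dvd g)"
proof -
  have nz: "f \<noteq> 0" "g \<noteq> 0" using assms by auto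
  show ?thesis
  proof
    assume "f = g"
    then show "f dvd g \<and> (\<forall>p\<in>prime_factors g. \<not> f * p dvd g)"
    proof (intro conjI ballI)
      fix p assume "p \<in> prime_factors g"
      then have "\<not> p dvd 1" using not_prime_unit by blast
      then show "\<not> f * p dvd g"
        using dvd_times_left_cancel_iff[OF nz(1), of p 1] \<open>f = g\<close> by simp
    qed simp
  next
    assume *: "f dvd g \<and> (\<forall>p\<in>prime_factors g. \<not> f * p dvd g)"
    then obtain c where c: "g = f * c" by blast
    have "is_unit c"
    proof (rule ccontr)
      assume "\<not> is_unit c"
      then obtain p where p: "prime p" "p dvd c" 
        using prime_divisor_exists[of c] c nz by auto
      then have "p \<in> prime_factors g" "f * p dvd g" using c nz by (auto simp: in_prime_factors_iff)
      with * show False by blast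
    qed
    then have "g dvd f" using c by auto
    with * assms show "f = g" by (intro monic_dvd_antisym) auto
  qed
qed

text \<open>
  Both sides say that \<open>g = f c\<close> for some \<open>c\<close> that is divisible by all primes in \<open>B\<close>.
\<close>

lemma mult_primes_dvd_iff_dvd_div:
  fixes f g :: "'k::field_gcd poly"
  assumes "g \<noteq> 0" "B \<subseteq> prime_factors g"
  shows "(f dvd g \<and> (\<forall>p\<in>B. f * p dvd g)) \<longleftrightarrow> f dvd g div \<Prod>B"
proof -
  have B: "finite B" "\<And>p. p \<in> B \<Longrightarrow> prime p" "\<And>p. p \<in> B \<Longrightarrow> p dvd g"
    using assms by (auto intro: finite_subset)
  have "\<Prod>B dvd g" using B by (simp add: prod_primes_dvd_iff)
  have "\<Prod>B \<noteq> 0" using \<open>\<Prod>B dvd g\<close> assms by auto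
  have "(f dvd g \<and> (\<forall>p\<in>B. f * p dvd g)) \<longleftrightarrow> f * \<Prod>B dvd g"
  proof (cases "f dvd g")
    case True
    then obtain c where c: "g = f * c" by blast
    with assms have "f \<noteq> 0" by auto
    then show ?thesis unfolding c using B by (simp add: prod_primes_dvd_iff)
  qed (auto dest: dvd_mult_left)
  also have "\<dots> \<longleftrightarrow> f * \<Prod>B dvd (g div \<Prod>B) * \<Prod>B" using \<open>\<Prod>B dvd g\<close> by simp
  also have "\<dots> \<longleftrightarrow> f dvd g div \<Prod>B" using \<open>\<Prod>B \<noteq> 0\<close> by simp
  finally show ?thesis .
qed

theorem theorem3p2:
  fixes \<iota> :: "'k::{finite,field_gcd} \<Rightarrow> 'a::{finite,field}"
    and m :: nat
    and f1 f2 g d :: "'k poly"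
    and \<alpha> :: 'a
  assumes "field_embedding \<iota>"
    and "m \<ge> 1"
    and "CARD('a) = CARD('k) ^ m"
    and "monom 1 m - 1 = f1 * f2"
    and "lead_coeff g = 1"
    and "g dvd monom 1 m - 1"
    and "fq_Order \<iota> \<alpha> = f1"
    and "d = g div gcd g f2"
  shows "(\<Sum>\<chi> | additive_character \<chi> \<and> char_Order \<iota> \<chi> = g. \<chi> \<alpha>)
           = of_int (poly_mu d) * of_nat (poly_phi g) / of_nat (poly_phi d)"
proof -
  interpret finite_field_extension \<iota> m
    by unfold_locales (use assms in auto)
  let ?q = "of_nat (CARD('k)) :: complex" and ?P = "prime_factors g"
  let ?X = "{\<chi>. additive_character \<chi> \<and> char_Order \<iota> \<chi> dvd g}"
  have "g \<noteq> 0" using assms(5) by auto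
  have gd: "g = gcd g f2 * d" using assms(8) by simp
  have "lead_coeff (gcd g f2) = 1"
  proof -
    have "normalize (gcd g f2) = gcd g f2" by simp
    then have "unit_factor (gcd g f2) = 1" using \<open>g \<noteq> 0\<close> by (simp add: unit_factor_gcd)
    then show ?thesis
      using \<open>g \<noteq> 0\<close> by (simp add: unit_factor_poly_def one_pCons is_unit_unit_factor dvd_field_iff)
  qed
  then have d: "lead_coeff d = 1" using gd assms(5) by (metis lead_coeff_mult mult_1)
  have "finite ?X" by (rule finite_subset[OF _ finite_additive_characters]) auto
  have "(\<Sum>\<chi> | additive_character \<chi> \<and> char_Order \<iota> \<chi> = g. \<chi> \<alpha>)
      = (\<Sum>\<chi> | \<chi> \<in> ?X \<and> (\<forall>p\<in>?P. \<not> char_Order \<iota> \<chi> * p dvd g). \<chi> \<alpha>)"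
  proof (rule sum.cong)
    have "char_Order \<iota> \<chi> = g \<longleftrightarrow> char_Order \<iota> \<chi> dvd g \<and> (\<forall>p\<in>?P. \<not> char_Order \<iota> \<chi> * p dvd g)"
      if "additive_character \<chi>" for \<chi>
      using char_Order(1)[OF that] assms(5) by (rule eq_iff_no_prime_gap)
    then show "{\<chi>. additive_character \<chi> \<and> char_Order \<iota> \<chi> = g}
        = {\<chi>. \<chi> \<in> ?X \<and> (\<forall>p\<in>?P. \<not> char_Order \<iota> \<chi> * p dvd g)}"
      by blast
  qed simp
  also have "\<dots> = (\<Sum>B\<in>Pow ?P. (-1) ^ card B
      * (\<Sum>\<chi> | \<chi> \<in> ?X \<and> (\<forall>p\<in>B. char_Order \<iota> \<chi> * p dvd g). \<chi> \<alpha>))"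
    using \<open>finite ?X\<close> by (rule sum_avoiding_eq_alternating_sum) simp
  also have "\<dots> = (\<Sum>B\<in>Pow ?P. if d dvd \<Prod>B
      then (-1) ^ card B * (?q ^ degree g / ?q ^ degree (\<Prod>B)) else 0)"
  proof (rule sum.cong)
    fix B assume "B \<in> Pow ?P"
    then have B: "B \<subseteq> ?P" "finite B" "\<And>p. p \<in> B \<Longrightarrow> prime p" "\<And>p. p \<in> B \<Longrightarrow> p dvd g"
      by (auto intro: finite_subset)
    let ?h = "g div \<Prod>B"
    have "\<Prod>B dvd g" using B by (simp add: prod_primes_dvd_iff)
    then have g: "g = ?h * \<Prod>B" by simp
    with \<open>g \<noteq> 0\<close> have nz: "?h \<noteq> 0" "\<Prod>B \<noteq> 0" by auto
    have "degree g = degree ?h + degree (\<Prod>B)" using g degree_mult_eq[OF nz] by simp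
    then have q: "?q ^ degree ?h = ?q ^ degree g / ?q ^ degree (\<Prod>B)" by (simp add: power_add)
    have "?h dvd modulus" using assms(6) g by (metis dvd_mult_left)
    have "?h dvd f2 \<longleftrightarrow> ?h * \<Prod>B dvd f2 * \<Prod>B" using nz by simp
    also have "\<dots> \<longleftrightarrow> d dvd \<Prod>B"
      using g dvd_mult_iff_div_gcd_dvd[OF \<open>g \<noteq> 0\<close>, of f2 "\<Prod>B"] assms(8) by simp
    finally have hd: "?h dvd f2 \<longleftrightarrow> d dvd \<Prod>B" .
    have "(\<Sum>\<chi> | \<chi> \<in> ?X \<and> (\<forall>p\<in>B. char_Order \<iota> \<chi> * p dvd g). \<chi> \<alpha>)
        = (\<Sum>\<chi> | additive_character \<chi> \<and> char_Order \<iota> \<chi> dvd ?h. \<chi> \<alpha>)"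
      using mult_primes_dvd_iff_dvd_div[OF \<open>g \<noteq> 0\<close> B(1)] by (intro sum.cong) auto
    also have "\<dots> = (if d dvd \<Prod>B then ?q ^ degree g / ?q ^ degree (\<Prod>B) else 0)"
      using sum_characters_Order_dvd[OF assms(4,7) \<open>?h dvd modulus\<close>] by (simp only: hd q)
    finally show "(-1) ^ card B * (\<Sum>\<chi> | \<chi> \<in> ?X \<and> (\<forall>p\<in>B. char_Order \<iota> \<chi> * p dvd g). \<chi> \<alpha>)
        = (if d dvd \<Prod>B then (-1) ^ card B * (?q ^ degree g / ?q ^ degree (\<Prod>B)) else 0)"
      by simp
  qed simp
  also have "\<dots> = (\<Sum>B | B \<subseteq> ?P \<and> d dvd \<Prod>B. (-1) ^ card B * (?q ^ degree g / ?q ^ degree (\<Prod>B)))"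
    by (subst sum.inter_filter[symmetric]) (simp_all add: Pow_def)
  also have "\<dots> = of_int (poly_mu d) * of_nat (poly_phi g) / of_nat (poly_phi d)"
    using \<open>g \<noteq> 0\<close> d gd by (intro alternating_sum_eq_mu_phi) (auto intro: dvdI[of _ _ "gcd g f2"] simp: mult.commute)
  finally show ?thesis .
qed

end
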